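(* Let $d \in \{2,3\}$, let $W \colon \mathbb{R}^{d \times d} \to \mathbb{R}_\infty$ be isotropic, and let $\Phi \colon \mathbb{R}^{d} \to \mathbb{R}_\infty$ be given by $\Phi(\nu) = W(\operatorname{diag}(\nu))$ for $\nu\in\mathbb{R}^d$. Then the following statements are equivalent: (i) $W$ is lower semicontinuous polyconvex; (ii) there exists a lower semicontinuous convex function $g \colon \mathbb{R}^{k_d} \to \mathbb{R}_\infty$ such that $W(\operatorname{diag}(\nu)) = g(m(\nu))$ for all $\nu \in \mathbb{R}^{d}$; (iii) $\Phi$ is lower semicontinuous polyconvex (in the sense of functions on $\mathbb{R}^d$).
   Context: $\mathbb{R}_\infty := \mathbb{R}\cup\{\infty\}$. $\mathrm{SO}(d)$ is the special orthogonal group. $\operatorname{diag}(\nu)$ is the diagonal $d\times d$ matrix with diagonal entries $\nu_1,\dots,\nu_d$. Isotropic: $W \colon \mathbb{R}^{d \times d} \to \mathbb{R}_\infty$ is isotropic if $W(F) = W(R_1 F R_2)$ for all $F \in \mathbb{R}^{d\times d}$ and $R_1,R_2\in \mathrm{SO}(d)$. Polyconvexity on matrices: let $\mathcal{M}(F)\in\mathbb{R}^{K_d}$, $K_d=\sum_{i=1}^d\binom{d}{i}^2$, be the vector of all minors of $F\in\mathbb{R}^{d\times d}$; that is, $\mathcal{M}(F)=(F,\det F)\in\mathbb{R}^5$ for $d=2$ and $\mathcal{M}(F)=(F,\operatorname{adj}(F)^\top,\det F)\in\mathbb{R}^{19}$ for $d=3$, where $\operatorname{adj}(F)$ is the adjugate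 matrix. $W \colon \mathbb{R}^{d \times d} \to \mathbb{R}_\infty$ is lower semicontinuous polyconvex if there is a lower semicontinuous convex function $G\colon\mathbb{R}^{K_d}\to\mathbb{R}_\infty$ with $W(F)=G(\mathcal{M}(F))$ for all $F\in\mathbb{R}^{d\times d}$. Polyconvexity on vectors: $k_d=2^d-1$, and $m\colon\mathbb{R}^d\to\mathbb{R}^{k_d}$ is $m(\nu)=(\nu_1,\nu_2,\nu_1\nu_2)$ for $d=2$ and $m(\nu)=(\nu_1,\nu_2,\nu_3,\nu_2\nu_3,\nu_1\nu_3,\nu_1\nu_2,\nu_1\nu_2\nu_3)$ for $d=3$. $\Phi\colon\mathbb{R}^d\to\mathbb{R}_\infty$ is lower semicontinuous polyconvex if there is a lower semicontinuous convex function $g\colon\mathbb{R}^{k_d}\to\mathbb{R}_\infty$ with $\Phi(\nu)=g(m(\nu))$ for all $\nu\in\mathbb{R}^d$. *)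

theory Defs
  imports "HOL-Analysis.Analysis"
begin

text \<open>
  Functions into \<open>\<real> \<union> {\<infinity>}\<close> are \<^typ>\<open>ereal\<close>-valued functions that omit the value \<open>-\<infinity>\<close>;
  the constant \<open>\<infinity>\<close> is allowed.
\<close>

definition into_Rinf :: "('a \<Rightarrow> ereal) \<Rightarrow> bool" where
  "into_Rinf f \<longleftrightarrow> (\<forall>x. f x \<noteq> -\<infinity>)"

definition lower_semicontinuous :: "('a::topological_space \<Rightarrow> ereal) \<Rightarrow> bool" where
  "lower_semicontinuous f \<longleftrightarrow> (\<forall>x. f x \<le> Liminf (at x) f)"

text \<open>For \<^typ>\<open>ereal\<close> one has \<open>0 * \<infinity> = 0\<close>, so the endpoints \<open>t = 0\<close> and \<open>t = 1\<close> impose nothing.\<close>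

definition convex_ereal :: "('a::real_vector \<Rightarrow> ereal) \<Rightarrow> bool" where
  "convex_ereal f \<longleftrightarrow> (\<forall>x y. \<forall>t\<in>{0..1}.
     f ((1 - t) *\<^sub>R x + t *\<^sub>R y) \<le> ereal (1 - t) * f x + ereal t * f y)"

definition lsc_convex :: "('a::euclidean_space \<Rightarrow> ereal) \<Rightarrow> bool" where
  "lsc_convex g \<longleftrightarrow> into_Rinf g \<and> lower_semicontinuous g \<and> convex_ereal g"

definition diag :: "real^'n \<Rightarrow> real^'n^'n" where
  "diag \<nu> = (\<chi> i j. if i = j then \<nu> $ i else 0)"

definition isotropic :: "(real^'n^'n \<Rightarrow> ereal) \<Rightarrow> bool" where
  "isotropic W \<longleftrightarrow> (\<forall>F R\<^sub>1 R\<^sub>2. rotation_matrix R\<^sub>1 \<longrightarrow> rotation_matrix R\<^sub>2 \<longrightarrow>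
     W F = W (R\<^sub>1 ** F ** R\<^sub>2))"

text \<open>
  Entry \<open>(i, j)\<close> of the adjugate is the signed minor of \<open>F\<close> with row \<open>j\<close> and column \<open>i\<close> deleted;
  it is written as the determinant of \<open>F\<close> with that row and column replaced by unit vectors,
  which includes the sign and avoids submatrices.
\<close>

definition adjugate :: "real^'n^'n \<Rightarrow> real^'n^'n" where
  "adjugate F = (\<chi> i j. det (\<chi> k l.
     if k = j \<and> l = i then 1 else if k = j \<or> l = i then 0 else F $ k $ l))"

lemma adjugate_3:
  fixes F :: "real^3^3"
  shows "adjugate F = vector [
    vector [F$2$2 * F$3$3 - F$2$3 * F$3$2, F$1$3 * F$3$2 - F$1$2 * F$3$3, F$1$2 * F$2$3 - F$1$3 * F$2$2],
    vector [F$2$3 * F$3$1 - F$2$1 * F$3$3, F$1$1 * F$3$3 - F$1$3 * F$3$1, F$1$3 * F$2$1 - F$1$1 * F$2$3],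
    vector [F$2$1 * F$3$2 - F$2$2 * F$3$1, F$1$2 * F$3$1 - F$1$1 * F$3$2, F$1$1 * F$2$2 - F$1$2 * F$2$1]]"
  by (simp add: vec_eq_iff forall_3 adjugate_def det_3)

text \<open>
  The spaces \<open>\<real>\<^sup>5\<close>, \<open>\<real>\<^sup>1\<^sup>9\<close>, \<open>\<real>\<^sup>3\<close>, \<open>\<real>\<^sup>7\<close> of minors are represented by product Euclidean spaces with
  the components grouped in blocks; see the dimension counts below.
\<close>

definition minors2 :: "real^2^2 \<Rightarrow> (real^2^2) \<times> real" where
  "minors2 F = (F, det F)"

definition minors3 :: "real^3^3 \<Rightarrow> (real^3^3) \<times> (real^3^3) \<times> real" where
  "minors3 F = (F, transpose (adjugate F), det F)"

definition m2 :: "real^2 \<Rightarrow> (real^2) \<times> real" where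
  "m2 \<nu> = (\<nu>, \<nu>$1 * \<nu>$2)"

definition m3 :: "real^3 \<Rightarrow> (real^3) \<times> (real^3) \<times> real" where
  "m3 \<nu> = (\<nu>, vector [\<nu>$2 * \<nu>$3, \<nu>$1 * \<nu>$3, \<nu>$1 * \<nu>$2], \<nu>$1 * \<nu>$2 * \<nu>$3)"

lemma DIM_minors:
  "DIM((real^2^2) \<times> real) = (\<Sum>i=1..2. (2 choose i)\<^sup>2)"
  "DIM((real^3^3) \<times> (real^3^3) \<times> real) = (\<Sum>i=1..3. (3 choose i)\<^sup>2)"
  "DIM((real^2) \<times> real) = 2 ^ 2 - 1"
  "DIM((real^3) \<times> (real^3) \<times> real) = 2 ^ 3 - 1"
  by (simp_all add: numeral_eq_Suc)

text \<open>
  The notion of polyconvexity relative to a map \<open>\<mu>\<close> of minors: on matrices \<open>\<mu>\<close> is \<^const>\<open>minors2\<close>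
  or \<^const>\<open>minors3\<close>, on vectors it is \<^const>\<open>m2\<close> or \<^const>\<open>m3\<close>.
\<close>

definition lsc_polyconvex :: "('a \<Rightarrow> 'b::euclidean_space) \<Rightarrow> ('a \<Rightarrow> ereal) \<Rightarrow> bool" where
  "lsc_polyconvex \<mu> f \<longleftrightarrow> (\<exists>g. lsc_convex g \<and> (\<forall>x. f x = g (\<mu> x)))"

end

theory Submission
  imports Defs
begin

text \<open>
  A lower semicontinuous convex \<open>g\<close> is the supremum of its affine minorants, so \<open>W\<close> is polyconvex as
  soon as every affine minorant \<open>\<nu> \<mapsto> a \<bullet> \<nu> + b \<bullet> cof \<nu> + c det \<nu> + e\<close> of \<open>\<Phi>\<close> extends to the
  minorant \<open>F \<mapsto> diag a \<bullet> F + diag b \<bullet> cof F + c det F + e\<close> of \<open>W\<close>. For \<open>F = P diag \<nu> Q\<^sup>T\<close> with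
  rotations \<open>P, Q\<close> the extension has the value \<open>a \<bullet> M \<nu> + b \<bullet> M cof \<nu> + c det \<nu> + e\<close>, where \<open>M\<close> is the
  entrywise product of \<open>P\<close> and \<open>Q\<close>. It therefore suffices that \<open>M\<close> is a convex combination of
  permutation matrices with an even number of sign changes, since \<open>\<Phi>\<close> is invariant under these.

  For \<open>d = 3\<close> these signed permutations form the symmetry group of a regular tetrahedron with vertices
  \<open>l\<^sub>0, \<dots>, l\<^sub>3\<close>, that is, the symmetric group on the vertices. The 4 by 4 matrix with entries
  \<open>(1 + l\<^sub>j \<bullet> M l\<^sub>k) / 4\<close> has row and column sums 1, and it is nonnegative because
  \<open>l\<^sub>j \<bullet> M l\<^sub>k\<close> is the trace of a rotation of three-space, hence at least \<open>-1\<close>. Birkhoff's theorem for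
  this doubly stochastic matrix gives the claim.
\<close>

subsection \<open>Lower semicontinuous convex functions\<close>

text \<open>The punctured filter may be replaced by the full one because \<open>y < f x\<close>
  already covers the centre.\<close>

lemma lower_semicontinuous_iff_eventually_nhds:
  "lower_semicontinuous f \<longleftrightarrow> (\<forall>x. \<forall>y < f x. eventually (\<lambda>z. y < f z) (nhds x))"
  unfolding lower_semicontinuous_def le_Liminf_iff eventually_nhds_conv_at by blast

lemma convex_epigraph:
  assumes "convex_ereal g"
  shows "convex {(z, s). g z \<le> ereal s}"
proof (rule convexI, clarsimp)
  fix x s y t and u v :: real
  assume *: "g x \<le> ereal s" "g y \<le> ereal t" "0 \<le> u" "0 \<le> v" "u + v = 1"
  then have u: "u = 1 - v" "v \<in> {0..1}" by auto
  have "g (u *\<^sub>R x + v *\<^sub>R y) \<le> ereal u * g x + ereal v * g y"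
    using assms u unfolding convex_ereal_def by blast
  also have "\<dots> \<le> ereal u * ereal s + ereal v * ereal t"
    using * by (intro add_mono ereal_mult_left_mono) auto
  finally show "g (u *\<^sub>R x + v *\<^sub>R y) \<le> ereal (u * s + v * t)" by simp
qed

lemma closed_epigraph:
  fixes g :: "'a::topological_space \<Rightarrow> ereal"
  assumes "lower_semicontinuous g"
  shows "closed {(z, s). g z \<le> ereal s}"
proof -
  have "eventually (\<lambda>p. p \<in> - {(z, s). g z \<le> ereal s}) (nhds (x, s))"
    if xs: "ereal s < g x" for x s
  proof -
    obtain r where r: "s < r" "ereal r < g x"
      using ereal_dense2[OF xs] by auto
    have "eventually (\<lambda>z. ereal r < g z) (nhds x)"
      using assms r by (auto simp: lower_semicontinuous_iff_eventually_nhds)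
    moreover have "eventually (\<lambda>t. t < r) (nhds s)"
      using r eventually_nhds_in_open[of "{..<r}" s] by auto
    ultimately have "eventually (\<lambda>(z, t). ereal r < g z \<and> t < r) (nhds x \<times>\<^sub>F nhds s)"
      unfolding eventually_prod_filter by blast
    then show ?thesis
      unfolding nhds_prod
      by eventually_elim (auto simp: not_le dest: less_le_trans)
  qed
  then have "\<exists>T. open T \<and> p \<in> T \<and> T \<subseteq> - {(z, s). g z \<le> ereal s}"
    if "p \<in> - {(z, s). g z \<le> ereal s}" for p
    using that unfolding eventually_nhds by (cases p) (metis (no_types, lifting) ComplD case_prodI mem_Collect_eq not_le subsetI)
  then show ?thesis
    unfolding closed_def by (subst open_subopen) blast
qed

text \<open>A hyperplane with normal \<open>(u, r)\<close> strictly separates \<open>(x, t)\<close>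
  from the closed convex epigraph. If the epigraph is nonempty, its upward closedness forces
  \<open>r \<ge> 0\<close>; division by \<open>r > 0\<close> gives the affine case, and
  \<open>r = 0\<close> can occur only if \<open>g x = \<infinity>\<close>.\<close>

lemma lsc_convex_nonvertical_minorant:
  fixes g :: "'a::euclidean_space \<Rightarrow> ereal"
  assumes "lsc_convex g" "ereal t < g x"
  obtains
    (affine) u e where "\<And>z. ereal (u \<bullet> z + e) \<le> g z" "t < u \<bullet> x + e"
  | (vertical) u b where "g x = \<infinity>" "u \<bullet> x < b" "\<And>z. g z \<noteq> \<infinity> \<Longrightarrow> b < u \<bullet> z"
proof -
  let ?E = "{(z, s). g z \<le> ereal s}"
  have g: "convex_ereal g" "lower_semicontinuous g" "\<And>z. g z \<noteq> -\<infinity>"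
    using assms by (auto simp: lsc_convex_def into_Rinf_def)
  have "(x, t) \<notin> ?E" using assms by auto
  then obtain c b where c: "c \<bullet> (x, t) < b" "\<And>p. p \<in> ?E \<Longrightarrow> b < c \<bullet> p"
    using separating_hyperplane_closed_point[OF convex_epigraph closed_epigraph] g by metis
  obtain u r where ur: "c = (u, r)" by (cases c)
  have below: "u \<bullet> x + r * t < b" and above: "\<And>z s. g z \<le> ereal s \<Longrightarrow> b < u \<bullet> z + r * s"
    using c ur by auto
  consider "\<And>z. g z = \<infinity>" | z0 s0 where "g z0 = ereal s0"
    using g(3) by (metis ereal_cases)
  then show ?thesis
  proof cases
    case 1
    then show ?thesis using affine[of 0 "t + 1"] by auto
  next
    case 2
    have "r \<ge> 0"
    proof (rule ccontr)
      assume "\<not> r \<ge> 0"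
      \<comment> \<open>At this height the point over \<open>z0\<close> still lies in the epigraph,
        yet a negative \<open>r\<close> puts it on the wrong side of the hyperplane.\<close>
      define s where "s = max s0 ((b - u \<bullet> z0) / r)"
      have "b < u \<bullet> z0 + r * s" using 2 by (intro above) (auto simp: s_def)
      moreover have "r * s \<le> b - u \<bullet> z0"
        using \<open>\<not> r \<ge> 0\<close> by (simp add: s_def max_def field_simps)
      ultimately show False by simp
    qed
    show ?thesis
    proof (cases "r = 0")
      case True
      have "b < u \<bullet> z" if "g z \<noteq> \<infinity>" for z
        using that g(3)[of z] above[of z] True by (cases "g z") auto
      moreover from this below True have "g x = \<infinity>" by force
      ultimately show ?thesis using below True by (intro vertical) auto
    next
      case False
      with \<open>r \<ge> 0\<close> have "r > 0" by simp
      show ?thesis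
      proof (rule affine)
        fix z
        show "ereal ((- (1 / r) *\<^sub>R u) \<bullet> z + b / r) \<le> g z"
          using g(3)[of z] above[of z] \<open>r > 0\<close> by (cases "g z") (auto simp: field_simps less_imp_le)
        show "t < (- (1 / r) *\<^sub>R u) \<bullet> x + b / r"
          using below \<open>r > 0\<close> by (simp add: field_simps)
      qed
    qed
  qed
qed

text \<open>A vertical hyperplane is tilted: to an affine minorant, found at a point where
  \<open>g\<close> is finite, one adds \<open>k * (b - u \<bullet> z)\<close>. This is negative
  wherever \<open>g\<close> is finite and positive at \<open>x\<close>, so a large \<open>k\<close>
  lifts the value at \<open>x\<close> above \<open>t\<close>.\<close>

lemma lsc_convex_affine_minorant:
  fixes g :: "'a::euclidean_space \<Rightarrow> ereal"
  assumes g: "lsc_convex g" and t: "ereal t < g x"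
  obtains u e where "\<And>z. ereal (u \<bullet> z + e) \<le> g z" "t < u \<bullet> x + e"
  using g t
proof (cases rule: lsc_convex_nonvertical_minorant)
  case (affine u e)
  then show ?thesis using that by blast
next
  case (vertical u b)
  show ?thesis
  proof (cases "\<forall>z. g z = \<infinity>")
    case True
    then show ?thesis using that[of 0 "t + 1"] by auto
  next
    case False
    then obtain z1 where z1: "g z1 \<noteq> \<infinity>" by blast
    obtain t1 where "ereal t1 < g z1"
      using g by (metis into_Rinf_def lsc_convex_def ereal_dense2 ereal_infty_less(2))
    with g obtain v e where v: "\<And>z. ereal (v \<bullet> z + e) \<le> g z"
      by (cases rule: lsc_convex_nonvertical_minorant) (use z1 in auto)
    obtain k where k: "k > 0" "t - (v \<bullet> x + e) < k * (b - u \<bullet> x)"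
    proof
      let ?k = "(\<bar>t - (v \<bullet> x + e)\<bar> + 1) / (b - u \<bullet> x)"
      show "?k > 0" using vertical by simp
      show "t - (v \<bullet> x + e) < ?k * (b - u \<bullet> x)" using vertical by simp
    qed
    show ?thesis
    proof (rule that)
      fix z
      show "ereal ((v - k *\<^sub>R u) \<bullet> z + (e + k * b)) \<le> g z"
      proof (cases "g z = \<infinity>")
        case False
        then have "k * b \<le> k * (u \<bullet> z)" using vertical k by (intro mult_left_mono) (auto simp: less_imp_le)
        then have "(v - k *\<^sub>R u) \<bullet> z + (e + k * b) \<le> v \<bullet> z + e"
          by (simp add: inner_diff_left)
        then show ?thesis using v[of z] by (meson ereal_less_eq(3) order_trans)
      qed auto
      show "t < (v - k *\<^sub>R u) \<bullet> x + (e + k * b)"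
        using k by (simp add: inner_diff_left algebra_simps)
    qed
  qed
qed

text \<open>The witness is the supremum of all affine functions that lie below \<open>f\<close> on
  the image of \<open>\<mu>\<close>. Such a supremum is convex and lower semicontinuous, and
  \<open>minorant\<close> makes it reach \<open>f\<close>.\<close>

lemma lsc_polyconvexI:
  fixes \<mu> :: "'a \<Rightarrow> 'b::euclidean_space"
  assumes f: "into_Rinf f"
    and minorant: "\<And>x t. ereal t < f x \<Longrightarrow>
      \<exists>u e. (\<forall>y. ereal (u \<bullet> \<mu> y + e) \<le> f y) \<and> t < u \<bullet> \<mu> x + e"
  shows "lsc_polyconvex \<mu> f"
proof -
  define M where "M = {(u, e). \<forall>y. ereal (u \<bullet> \<mu> y + e) \<le> f y}"
  define G where "G z = (SUP (u, e)\<in>M. ereal (u \<bullet> z + e))" for z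
  have upper: "ereal (u \<bullet> z + e) \<le> G z" if "(u, e) \<in> M" for u e z
    unfolding G_def using that by (auto intro!: SUP_upper2)
  \<comment> \<open>One member of \<open>M\<close> keeps the supremum away from
    \<open>-\<infinity>\<close>; the point \<open>undefined\<close> is arbitrary.\<close>
  obtain u0 e0 where M0: "(u0, e0) \<in> M"
  proof -
    obtain t where "ereal t < f undefined"
      using f by (metis into_Rinf_def ereal_dense2 ereal_less_eq(2) order_less_le)
    from minorant[OF this] show ?thesis using that by (auto simp: M_def)
  qed
  have "into_Rinf G"
    unfolding into_Rinf_def using upper[OF M0] by (metis MInfty_neq_ereal(1) ereal_infty_less_eq(2))
  moreover have "lower_semicontinuous G"
    unfolding lower_semicontinuous_iff_eventually_nhds
  proof (intro allI impI)
    fix x y assume "y < G x"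
    then obtain u e where ue: "(u, e) \<in> M" "y < ereal (u \<bullet> x + e)"
      unfolding G_def by (auto simp: less_SUP_iff)
    have "((\<lambda>z. ereal (u \<bullet> z + e)) \<longlongrightarrow> ereal (u \<bullet> x + e)) (nhds x)"
      by (intro tendsto_intros filterlim_ident)
    from order_tendstoD(1)[OF this ue(2)]
    show "eventually (\<lambda>z. y < G z) (nhds x)"
      by eventually_elim (use upper ue in \<open>auto intro: less_le_trans\<close>)
  qed
  moreover have "convex_ereal G"
    unfolding convex_ereal_def
  proof (intro allI ballI)
    fix x y and t :: real assume t: "t \<in> {0..1}"
    show "G ((1 - t) *\<^sub>R x + t *\<^sub>R y) \<le> ereal (1 - t) * G x + ereal t * G y"
      unfolding G_def[of "(1 - t) *\<^sub>R x + t *\<^sub>R y"]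
    proof (rule SUP_least, clarify)
      fix u e assume M: "(u, e) \<in> M"
      have "ereal (u \<bullet> ((1 - t) *\<^sub>R x + t *\<^sub>R y) + e)
          = ereal (1 - t) * ereal (u \<bullet> x + e) + ereal t * ereal (u \<bullet> y + e)"
        by (simp add: inner_add_right algebra_simps)
      also have "\<dots> \<le> ereal (1 - t) * G x + ereal t * G y"
        using t upper[OF M] by (intro add_mono ereal_mult_left_mono) auto
      finally show "ereal (u \<bullet> ((1 - t) *\<^sub>R x + t *\<^sub>R y) + e) \<le> ereal (1 - t) * G x + ereal t * G y" .
    qed
  qed
  moreover have "f x = G (\<mu> x)" for x
  proof (rule antisym)
    show "G (\<mu> x) \<le> f x" unfolding G_def by (rule SUP_least) (auto simp: M_def)
    show "f x \<le> G (\<mu> x)"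
    proof (rule ereal_le_real, rule ccontr)
      fix t assume "G (\<mu> x) \<le> ereal t" "\<not> f x \<le> ereal t"
      then obtain u e where "(u, e) \<in> M" "t < u \<bullet> \<mu> x + e"
        using minorant[of t x] by (auto simp: M_def not_le)
      then show False using upper[of u e "\<mu> x"] \<open>G (\<mu> x) \<le> ereal t\<close>
        by (metis ereal_less_eq(3) not_less order_trans)
    qed
  qed
  ultimately show ?thesis unfolding lsc_polyconvex_def lsc_convex_def by blast
qed

lemma lsc_convex_compose_linear:
  fixes h :: "'a::euclidean_space \<Rightarrow> 'b::euclidean_space"
  assumes G: "lsc_convex G" and h: "linear h"
  shows "lsc_convex (\<lambda>x. G (h x))"
  unfolding lsc_convex_def
proof (intro conjI)
  show "into_Rinf (\<lambda>x. G (h x))" using G by (auto simp: lsc_convex_def into_Rinf_def)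
  show "convex_ereal (\<lambda>x. G (h x))"
    unfolding convex_ereal_def linear_add[OF h] linear_scale[OF h]
    using G unfolding lsc_convex_def convex_ereal_def by blast
  show "lower_semicontinuous (\<lambda>x. G (h x))"
    unfolding lower_semicontinuous_iff_eventually_nhds
  proof (intro allI impI)
    fix x y assume "y < G (h x)"
    then have "eventually (\<lambda>z. y < G z) (nhds (h x))"
      using G by (auto simp: lsc_convex_def lower_semicontinuous_iff_eventually_nhds)
    moreover have "filterlim h (nhds (h x)) (nhds x)"
      using linear_continuous_at[OF h[unfolded linear_conv_bounded_linear], of x]
      by (simp add: continuous_at tendsto_at_iff_tendsto_nhds)
    ultimately show "eventually (\<lambda>z. y < G (h z)) (nhds x)"
      by (rule eventually_compose_filterlim)
  qed
qed

subsection \<open>Hall's and Birkhoff's theorems\<close>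

text \<open>Induction on \<open>card I\<close>. If a nonempty proper \<open>J\<close> is tight, it
  is matched inside its neighbourhood \<open>U\<close> and the rest outside \<open>U\<close>;
  counting the neighbours of \<open>K \<union> J\<close> gives the condition there. Otherwise every
  nonempty proper subset has a spare neighbour, so one index may take any \<open>x\<close> of its
  set.\<close>

lemma hall_marriage:
  fixes S :: "'i \<Rightarrow> 'b set"
  assumes "finite I" "\<And>i. i \<in> I \<Longrightarrow> finite (S i)"
    and "\<And>J. J \<subseteq> I \<Longrightarrow> card J \<le> card (\<Union>(S ` J))"
  shows "\<exists>f. inj_on f I \<and> (\<forall>i\<in>I. f i \<in> S i)"
  using assms
proof (induction "card I" arbitrary: I S rule: less_induct)
  case less
  note fin = less.prems(1,2) and hall = less.prems(3)
  show ?case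
  proof (cases "I = {}")
    case False
    show ?thesis
    proof (cases "\<exists>J\<subset>I. J \<noteq> {} \<and> card J = card (\<Union>(S ` J))")
      case True
      then obtain J where J: "J \<subset> I" "J \<noteq> {}" "card J = card (\<Union>(S ` J))" by blast
      define U where "U = \<Union>(S ` J)"
      have finJ: "finite J" using J fin by (auto intro: finite_subset)
      have "\<exists>f. inj_on f J \<and> (\<forall>i\<in>J. f i \<in> S i)"
        using J fin hall finJ by (intro less.hyps psubset_card_mono) auto
      then obtain f where f: "inj_on f J" "\<And>i. i \<in> J \<Longrightarrow> f i \<in> S i" by blast
      have "\<exists>h. inj_on h (I - J) \<and> (\<forall>i\<in>I - J. h i \<in> S i - U)"
      proof (intro less.hyps)
        show "card (I - J) < card I" using J fin by (intro psubset_card_mono) auto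
        fix K assume K: "K \<subseteq> I - J"
        have finK: "finite K" using K fin by (auto intro: finite_subset)
        have "card K + card J = card (K \<union> J)"
          using K finK finJ by (intro card_Un_disjoint[symmetric]) auto
        also have "\<dots> \<le> card (\<Union>(S ` (K \<union> J)))" using K J by (intro hall) auto
        also have "\<Union>(S ` (K \<union> J)) = (\<Union>i\<in>K. S i - U) \<union> U" by (auto simp: U_def)
        also have "card \<dots> \<le> card (\<Union>i\<in>K. S i - U) + card U" by (rule card_Un_le)
        finally show "card K \<le> card (\<Union>i\<in>K. S i - U)" using J by (simp add: U_def)
      qed (use fin in auto)
      then obtain h where h: "inj_on h (I - J)" "\<And>i. i \<in> I - J \<Longrightarrow> h i \<in> S i - U" by blast
      have "f i \<in> U" if "i \<in> J" for i using that f by (auto simp: U_def)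
      then have "inj_on (\<lambda>i. if i \<in> J then f i else h i) I"
        using f(1) h unfolding inj_on_def by (metis DiffE DiffI)
      then show ?thesis using f h by (intro exI[of _ "\<lambda>i. if i \<in> J then f i else h i"]) auto
    next
      case tight: False
      obtain i where i: "i \<in> I" using False by blast
      then obtain x where x: "x \<in> S i" using hall[of "{i}"] by fastforce
      have "\<exists>h. inj_on h (I - {i}) \<and> (\<forall>j\<in>I - {i}. h j \<in> S j - {x})"
      proof (intro less.hyps)
        show "card (I - {i}) < card I" using i fin by (intro psubset_card_mono) auto
        fix K assume K: "K \<subseteq> I - {i}"
        have "finite (\<Union>(S ` K))" using K fin by (auto intro: finite_subset)
        have "card K \<le> card (\<Union>(S ` K) - {x})"
        proof (cases "K = {}")
          case False
          have "K \<subset> I" using K i by blast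
          then have "card K \<noteq> card (\<Union>(S ` K))" "card K \<le> card (\<Union>(S ` K))"
            using tight hall[of K] False by auto
          then show ?thesis using \<open>finite (\<Union>(S ` K))\<close>
            by (cases "x \<in> \<Union>(S ` K)") (auto simp: card_Diff_singleton_if)
        qed auto
        also have "\<Union>(S ` K) - {x} = (\<Union>j\<in>K. S j - {x})" by auto
        finally show "card K \<le> card (\<Union>j\<in>K. S j - {x})" .
      qed (use fin in auto)
      then obtain h where h: "inj_on h (I - {i})" "\<And>j. j \<in> I - {i} \<Longrightarrow> h j \<in> S j - {x}" by blast
      have "inj_on (h(i := x)) I"
        using h unfolding inj_on_def by (auto split: if_splits)
      then show ?thesis using h x by (intro exI[of _ "h(i := x)"]) auto
    qed
  qed auto
qed

text \<open>Hall's condition for the support: the mass \<open>s * card J\<close> of the rows in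
  \<open>J\<close> lies entirely in the neighbouring columns, whose total mass is \<open>s\<close>
  times their number.\<close>

lemma doubly_stochastic_positive_diagonal:
  fixes X :: "'a \<Rightarrow> 'a \<Rightarrow> real"
  assumes A: "finite A" and nonneg: "\<And>a b. a \<in> A \<Longrightarrow> b \<in> A \<Longrightarrow> 0 \<le> X a b"
    and rows: "\<And>a. a \<in> A \<Longrightarrow> (\<Sum>b\<in>A. X a b) = s"
    and cols: "\<And>b. b \<in> A \<Longrightarrow> (\<Sum>a\<in>A. X a b) = s"
    and "s > 0"
  obtains p where "p permutes A" "\<And>a. a \<in> A \<Longrightarrow> 0 < X a (p a)"
proof -
  define S where "S a = {b \<in> A. 0 < X a b}" for a
  have "\<exists>f. inj_on f A \<and> (\<forall>a\<in>A. f a \<in> S a)"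
  proof (rule hall_marriage)
    fix J assume J: "J \<subseteq> A"
    let ?U = "\<Union>(S ` J)"
    have finJ: "finite J" using J A finite_subset by blast
    have U: "?U \<subseteq> A" by (auto simp: S_def)
    have "s * card J = (\<Sum>a\<in>J. \<Sum>b\<in>A. X a b)"
      using J rows by (simp add: subset_iff)
    also have "\<dots> = (\<Sum>a\<in>J. \<Sum>b\<in>?U. X a b)"
    proof (rule sum.cong[OF refl], rule sum.mono_neutral_right, goal_cases)
      case (3 a)
      show ?case using nonneg[of a] J 3 by (force simp: S_def subset_iff)
    qed (use A U in auto)
    also have "\<dots> = (\<Sum>b\<in>?U. \<Sum>a\<in>J. X a b)" by (rule sum.swap)
    also have "\<dots> \<le> (\<Sum>b\<in>?U. \<Sum>a\<in>A. X a b)"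
      using U J A nonneg by (intro sum_mono sum_mono2) auto
    also have "\<dots> = s * card ?U" using U cols by (simp add: subset_iff)
    finally show "card J \<le> card ?U" using \<open>s > 0\<close> by simp
  qed (use A in \<open>auto simp: S_def\<close>)
  then obtain f where f: "inj_on f A" "\<And>a. a \<in> A \<Longrightarrow> f a \<in> S a" by blast
  let ?p = "\<lambda>a. if a \<in> A then f a else a"
  have "f ` A = A" using f A by (intro endo_inj_surj) (auto simp: S_def)
  then have "bij_betw f A A" using f by (simp add: bij_betw_def)
  then have "bij_betw ?p A A" by (simp cong: bij_betw_cong)
  then have "?p permutes A" by (rule bij_imp_permutes) simp
  moreover have "0 < X a (?p a)" if "a \<in> A" for a using f that by (auto simp: S_def)
  ultimately show ?thesis using that by blast
qed

text \<open>The common value \<open>s\<close> of all row and column sums is kept as a parameter, so that subtracting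
  a multiple of a permutation matrix stays within the class.\<close>

lemma birkhoff_linear_bound:
  fixes X C :: "'a \<Rightarrow> 'a \<Rightarrow> real"
  assumes A: "finite A" and nonneg: "\<And>a b. a \<in> A \<Longrightarrow> b \<in> A \<Longrightarrow> 0 \<le> X a b"
    and rows: "\<And>a. a \<in> A \<Longrightarrow> (\<Sum>b\<in>A. X a b) = s"
    and cols: "\<And>b. b \<in> A \<Longrightarrow> (\<Sum>a\<in>A. X a b) = s"
    and bound: "\<And>p. p permutes A \<Longrightarrow> (\<Sum>a\<in>A. C a (p a)) \<le> K"
    and "s \<ge> 0"
  shows "(\<Sum>a\<in>A. \<Sum>b\<in>A. X a b * C a b) \<le> s * K"
  using nonneg rows cols \<open>s \<ge> 0\<close>
proof (induction "card {(a, b) \<in> A \<times> A. X a b \<noteq> 0}" arbitrary: X s rule: less_induct)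
  case less
  note nn = less.prems(1) and rs = less.prems(2) and cs = less.prems(3)
  show ?case
  proof (cases "s = 0 \<or> A = {}")
    case True
    have "X a b = 0" if "a \<in> A" "b \<in> A" for a b
      using True rs[OF that(1)] nn that A sum_nonneg_eq_0_iff[of A "X a"] by auto
    then have "(\<Sum>a\<in>A. \<Sum>b\<in>A. X a b * C a b) = 0" by (intro sum.neutral ballI) auto
    then show ?thesis using True bound[OF permutes_id] \<open>s \<ge> 0\<close> by auto
  next
    case False
    then have "s > 0" "A \<noteq> {}" using less.prems by auto
    obtain p where p: "p permutes A" "\<And>a. a \<in> A \<Longrightarrow> 0 < X a (p a)"
      using doubly_stochastic_positive_diagonal[OF A nn rs cs \<open>s > 0\<close>] by blast
    \<comment> \<open>Subtracting the least entry on the positive diagonal keeps the matrix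
      nonnegative and creates a new zero at \<open>(a0, p a0)\<close>, so the support
      shrinks.\<close>
    define \<theta> where "\<theta> = Min ((\<lambda>a. X a (p a)) ` A)"
    have \<theta>: "\<theta> > 0" "\<And>a. a \<in> A \<Longrightarrow> \<theta> \<le> X a (p a)"
      using A \<open>A \<noteq> {}\<close> p by (auto simp: \<theta>_def Min_gr_iff)
    have "\<theta> \<in> (\<lambda>a. X a (p a)) ` A"
      unfolding \<theta>_def using A \<open>A \<noteq> {}\<close> by (intro Min_in) auto
    then obtain a0 where a0: "a0 \<in> A" "X a0 (p a0) = \<theta>" by auto
    define Y where "Y a b = X a b - (if b = p a then \<theta> else 0)" for a b
    have pA: "p a \<in> A" if "a \<in> A" for a using that p(1) by (simp add: permutes_in_image)
    have inv: "b = p a \<longleftrightarrow> a = inv p b" for a b using p(1) by (metis permutes_inverses)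
    have "(\<Sum>a\<in>A. \<Sum>b\<in>A. Y a b * C a b) \<le> (s - \<theta>) * K"
    proof (rule less.hyps)
      have "{(a, b) \<in> A \<times> A. Y a b \<noteq> 0} \<subset> {(a, b) \<in> A \<times> A. X a b \<noteq> 0}"
      proof
        show "{(a, b) \<in> A \<times> A. Y a b \<noteq> 0} \<subseteq> {(a, b) \<in> A \<times> A. X a b \<noteq> 0}"
          using p(2) by (force simp: Y_def split: if_splits)
        have "(a0, p a0) \<in> {(a, b) \<in> A \<times> A. X a b \<noteq> 0}" "(a0, p a0) \<notin> {(a, b) \<in> A \<times> A. Y a b \<noteq> 0}"
          using a0 \<theta> pA by (auto simp: Y_def)
        then show "{(a, b) \<in> A \<times> A. Y a b \<noteq> 0} \<noteq> {(a, b) \<in> A \<times> A. X a b \<noteq> 0}" by blast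
      qed
      then show "card {(a, b) \<in> A \<times> A. Y a b \<noteq> 0} < card {(a, b) \<in> A \<times> A. X a b \<noteq> 0}"
        using A by (intro psubset_card_mono) (auto intro: finite_subset[of _ "A \<times> A"])
      show "0 \<le> Y a b" if "a \<in> A" "b \<in> A" for a b
        using that nn \<theta> by (auto simp: Y_def)
      show "(\<Sum>b\<in>A. Y a b) = s - \<theta>" if "a \<in> A" for a
        using that rs pA A by (simp add: Y_def sum_subtractf)
      show "(\<Sum>a\<in>A. Y a b) = s - \<theta>" if "b \<in> A" for b
        using that cs p(1) A by (simp add: Y_def sum_subtractf inv permutes_in_image[OF permutes_inv])
      have "X a0 (p a0) \<le> (\<Sum>b\<in>A. X a0 b)"
        using a0 A pA nn by (intro member_le_sum) auto
      then show "s - \<theta> \<ge> 0" using a0 rs by simp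
    qed
    moreover have "(\<Sum>a\<in>A. \<Sum>b\<in>A. X a b * C a b)
        = (\<Sum>a\<in>A. \<Sum>b\<in>A. Y a b * C a b) + \<theta> * (\<Sum>a\<in>A. C a (p a))"
    proof -
      have "(\<Sum>b\<in>A. X a b * C a b) = (\<Sum>b\<in>A. Y a b * C a b) + \<theta> * C a (p a)" if "a \<in> A" for a
      proof -
        have "(\<Sum>b\<in>A. X a b * C a b)
            = (\<Sum>b\<in>A. Y a b * C a b + (if b = p a then \<theta> * C a b else 0))"
          by (intro sum.cong) (auto simp: Y_def algebra_simps)
        then show ?thesis using pA that A by (simp add: sum.distrib)
      qed
      then show ?thesis by (simp add: sum.distrib sum_distrib_left)
    qed
    moreover have "\<theta> * (\<Sum>a\<in>A. C a (p a)) \<le> \<theta> * K"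
      using \<theta> bound[OF p(1)] by (intro mult_left_mono) auto
    ultimately show ?thesis by (simp add: algebra_simps)
  qed
qed

subsection \<open>Rotations and singular values\<close>

lemma rotation_matrix_mult:
  fixes P Q :: "real^'n^'n"
  shows "rotation_matrix P \<Longrightarrow> rotation_matrix Q \<Longrightarrow> rotation_matrix (P ** Q)"
  by (auto simp: rotation_matrix_def orthogonal_matrix_mul det_mul)

lemma rotation_matrix_transpose:
  fixes P :: "real^'n^'n"
  shows "rotation_matrix P \<Longrightarrow> rotation_matrix (transpose P)"
  by (auto simp: rotation_matrix_def det_transpose)

lemma rotation_matrix_transpose_mult:
  fixes P :: "real^'n^'n"
  assumes "rotation_matrix P"
  shows "transpose P ** P = mat 1" "P ** transpose P = mat 1"
  using assms by (auto simp: rotation_matrix_def orthogonal_matrix_def)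

lemma compact_rotation_matrices: "compact {R :: real^'n^'n. rotation_matrix R}"
proof -
  have "norm R \<le> CARD('n)" if "rotation_matrix R" for R :: "real^'n^'n"
  proof -
    have "norm R \<le> (\<Sum>i\<in>UNIV. norm (R $ i))"
      unfolding norm_vec_def by (intro L2_set_le_sum) auto
    also have "\<dots> = (\<Sum>i\<in>(UNIV :: 'n set). 1)"
      using that by (intro sum.cong)
        (auto simp: rotation_matrix_def orthogonal_matrix_orthonormal_rows row_def)
    finally show ?thesis by simp
  qed
  then have "bounded {R :: real^'n^'n. rotation_matrix R}"
    unfolding bounded_iff by blast
  moreover have "closed {R :: real^'n^'n. rotation_matrix R}"
    unfolding rotation_matrix_def orthogonal_matrix matrix_matrix_mult_def transpose_def det_def
    by (intro closed_Collect_conj closed_Collect_eq continuous_intros continuous_on_vec_lambda)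
  ultimately show ?thesis by (simp add: compact_eq_bounded_closed)
qed

text \<open>Rotation by \<open>\<theta>\<close> in the plane of the coordinates \<open>i\<close> and
  \<open>j\<close>, provided that \<open>i \<noteq> j\<close>.\<close>

definition givens :: "'n \<Rightarrow> 'n \<Rightarrow> real \<Rightarrow> real^'n^'n" where
  "givens i j \<theta> = (\<chi> k l.
     if k = l then (if k = i \<or> k = j then cos \<theta> else 1)
     else if k = i \<and> l = j then - sin \<theta> else if k = j \<and> l = i then sin \<theta> else 0)"

lemma givens_mult:
  fixes A :: "real^'m^'n"
  assumes "i \<noteq> j"
  shows "(givens i j \<theta> ** A) $ k $ l =
    (if k = i then cos \<theta> * A $ i $ l - sin \<theta> * A $ j $ l
     else if k = j then sin \<theta> * A $ i $ l + cos \<theta> * A $ j $ l else A $ k $ l)"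
proof -
  have "givens i j \<theta> $ k $ m * A $ m $ l =
      (if k = i then (if m = i then cos \<theta> * A $ i $ l else 0) + (if m = j then - sin \<theta> * A $ j $ l else 0)
       else if k = j then (if m = i then sin \<theta> * A $ i $ l else 0) + (if m = j then cos \<theta> * A $ j $ l else 0)
       else if m = k then A $ k $ l else 0)" for m
    using assms by (auto simp: givens_def)
  then show ?thesis by (simp add: matrix_matrix_mult_def sum.distrib)
qed

lemma givens_add: "i \<noteq> j \<Longrightarrow> givens i j \<alpha> ** givens i j \<beta> = givens i j (\<alpha> + \<beta>)"
  by (auto simp: vec_eq_iff givens_mult) (auto simp: givens_def cos_add sin_add)

lemma rotation_matrix_givens:
  assumes "i \<noteq> j"
  shows "rotation_matrix (givens i j \<theta>)"
proof -
  have "transpose (givens i j \<theta>) = givens i j (- \<theta>)" for \<theta>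
    using assms by (auto simp: vec_eq_iff transpose_def givens_def)
  moreover have "givens i j 0 = mat 1"
    by (auto simp: vec_eq_iff givens_def mat_def)
  ultimately have orth: "orthogonal_matrix (givens i j \<theta>)" for \<theta>
    using assms by (simp add: orthogonal_matrix givens_add)
  \<comment> \<open>Halving the angle exhibits the determinant as the square of a number that is 1
    or -1, so no expansion is required.\<close>
  have "det (givens i j \<theta>) = det (givens i j (\<theta> / 2)) * det (givens i j (\<theta> / 2))"
    using assms by (simp flip: det_mul add: givens_add)
  with det_orthogonal_matrix[OF orth[of "\<theta> / 2"]] orth show ?thesis
    by (auto simp: rotation_matrix_def)
qed

lemma cos_sin_maximum_at_0:
  fixes a b :: real
  assumes "\<And>\<theta>. a * cos \<theta> + b * sin \<theta> \<le> a"
  shows "b = 0"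
proof -
  have "((\<lambda>\<theta>. a * cos \<theta> + b * sin \<theta>) has_real_derivative b) (at 0)"
    by (auto intro!: derivative_eq_intros)
  then show ?thesis
    by (rule DERIV_local_max[where d = 1]) (use assms in auto)
qed

text \<open>A plane rotation from the left mixes only the rows \<open>i\<close> and
  \<open>j\<close>, so the weighted trace is a constant plus
  \<open>a cos \<theta> + b sin \<theta>\<close> with
  \<open>b = d j * A $ i $ j - d i * A $ j $ i\<close>. The maximum at angle 0 forces
  \<open>b = 0\<close>.\<close>

lemma givens_maximum_symmetric:
  fixes A :: "real^'n^'n" and d :: "'n \<Rightarrow> real"
  assumes "i \<noteq> j"
    and max: "\<And>R. rotation_matrix R \<Longrightarrow> (\<Sum>k\<in>UNIV. d k * (R ** A) $ k $ k) \<le> (\<Sum>k\<in>UNIV. d k * A $ k $ k)"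
  shows "d j * A $ i $ j = d i * A $ j $ i"
proof -
  let ?S = "UNIV - {i, j}"
  have split: "(\<Sum>k\<in>UNIV. f k) = f i + f j + (\<Sum>k\<in>?S. f k)" for f :: "'n \<Rightarrow> real"
    using assms(1) sum.subset_diff[of "{i, j}" UNIV f] by simp
  have "(d i * A $ i $ i + d j * A $ j $ j) * cos \<theta> + (d j * A $ i $ j - d i * A $ j $ i) * sin \<theta>
      \<le> d i * A $ i $ i + d j * A $ j $ j" for \<theta>
    using max[OF rotation_matrix_givens[OF assms(1), of \<theta>]] assms(1)
    unfolding split by (simp add: givens_mult algebra_simps)
  from cos_sin_maximum_at_0[OF this] show ?thesis by simp
qed

text \<open>Among all \<open>R\<^sub>1 F R\<^sub>2\<close> pick the one maximising the trace against a fixed diagonal matrix with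
  distinct positive entries \<open>d\<close>. Stationarity under plane rotations from both sides gives
  \<open>d\<^sub>j A\<^sub>i\<^sub>j = d\<^sub>i A\<^sub>j\<^sub>i\<close> and \<open>d\<^sub>i A\<^sub>i\<^sub>j = d\<^sub>j A\<^sub>j\<^sub>i\<close>, hence \<open>d\<^sub>i\<^sup>2 A\<^sub>i\<^sub>j = d\<^sub>j\<^sup>2 A\<^sub>i\<^sub>j\<close>.\<close>

lemma signed_singular_value_decomposition:
  fixes F :: "real^'n^'n"
  obtains P Q \<nu> where "rotation_matrix P" "rotation_matrix Q" "F = P ** diag \<nu> ** transpose Q"
proof -
  obtain h :: "'n \<Rightarrow> nat" where h: "inj h"
    using finite_imp_inj_to_nat_seg[of "UNIV :: 'n set"] by auto
  define d where "d k = real (h k) + 1" for k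
  have d: "d k > 0" "i \<noteq> j \<Longrightarrow> d i \<noteq> d j" for i j k
    using h by (auto simp: d_def inj_def)
  let ?SO = "{R :: real^'n^'n. rotation_matrix R}"
  let ?f = "\<lambda>A :: real^'n^'n. \<Sum>k\<in>UNIV. d k * A $ k $ k"
  have "mat 1 \<in> ?SO" by (simp add: rotation_matrix_def orthogonal_matrix_id)
  then have "\<exists>x\<in>?SO \<times> ?SO. \<forall>y\<in>?SO \<times> ?SO. ?f (fst y ** F ** snd y) \<le> ?f (fst x ** F ** snd x)"
    by (intro continuous_attains_sup compact_Times compact_rotation_matrices)
      (auto simp: matrix_matrix_mult_def intro!: continuous_intros)
  then obtain P Q where PQ: "rotation_matrix P" "rotation_matrix Q"
    and max: "\<And>P' Q'. rotation_matrix P' \<Longrightarrow> rotation_matrix Q' \<Longrightarrow> ?f (P' ** F ** Q') \<le> ?f (P ** F ** Q)"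
    by auto
  define A where "A = P ** F ** Q"
  have left: "d j * A $ i $ j = d i * A $ j $ i" if "i \<noteq> j" for i j
  proof (rule givens_maximum_symmetric[OF that])
    fix R :: "real^'n^'n" assume "rotation_matrix R"
    then show "?f (R ** A) \<le> ?f A"
      using max[of "R ** P" Q] PQ by (simp add: A_def matrix_mul_assoc rotation_matrix_mult)
  qed
  \<comment> \<open>Multiplication from the right becomes multiplication of the transpose from the
    left, and transposition keeps the diagonal.\<close>
  have right: "d j * transpose A $ i $ j = d i * transpose A $ j $ i" if "i \<noteq> j" for i j
  proof (rule givens_maximum_symmetric[OF that])
    fix R :: "real^'n^'n" assume "rotation_matrix R"
    moreover have "R ** transpose A = transpose (A ** transpose R)" by (simp add: matrix_transpose_mul)
    ultimately show "?f (R ** transpose A) \<le> ?f (transpose A)"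
      using max[of P "Q ** transpose R"] PQ
      by (simp add: A_def matrix_mul_assoc rotation_matrix_mult rotation_matrix_transpose)
        (simp add: transpose_def)
  qed
  have "A $ i $ j = 0" if "i \<noteq> j" for i j
  proof -
    have "d j * A $ i $ j = d i * A $ j $ i" "d j * A $ j $ i = d i * A $ i $ j"
      using left[OF that] right[OF that] by (auto simp: transpose_def)
    then have "(d i * d i - d j * d j) * A $ i $ j = 0" by algebra
    moreover have "d i * d i \<noteq> d j * d j"
      using d[of i] d[of j] that by (metis abs_of_pos power2_eq_iff_nonneg power2_eq_square less_imp_le)
    ultimately show ?thesis by simp
  qed
  then have A: "A = diag (\<chi> k. A $ k $ k)" by (auto simp: vec_eq_iff diag_def)
  have "transpose P ** A ** transpose Q = (transpose P ** P) ** F ** (Q ** transpose Q)"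
    by (simp add: A_def matrix_mul_assoc)
  then have "F = transpose P ** A ** transpose Q"
    using PQ by (simp add: rotation_matrix_transpose_mult)
  with A show ?thesis using that PQ rotation_matrix_transpose by metis
qed

section \<open>Trace inner product and reduction to diagonal matrices\<close>

lemma matrix_inner_eq_trace:
  fixes A B :: "real^'n^'m"
  shows "A \<bullet> B = trace (transpose A ** B)"
  by (simp add: inner_vec_def trace_def matrix_matrix_mult_def transpose_def) (rule sum.swap)

text \<open>Cyclicity of the trace. It moves rotations from \<open>F\<close> onto the coefficient
  matrices of a minorant.\<close>

lemma matrix_inner_conjugate:
  fixes A B :: "real^'n^'n"
  shows "A \<bullet> (transpose P ** B ** Q) = (P ** A ** transpose Q) \<bullet> B"
proof -
  have "trace (transpose A ** (transpose P ** B ** Q)) = trace (Q ** (transpose A ** transpose P ** B))"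
    by (subst trace_mul_sym) (simp add: matrix_mul_assoc)
  then show ?thesis
    by (simp add: matrix_inner_eq_trace matrix_transpose_mul matrix_mul_assoc)
qed

text \<open>Only the diagonal of the conjugated matrix meets \<open>diag a\<close>, and its entry
  \<open>i\<close> is the sum over \<open>j\<close> of \<open>P_ij Q_ij \<nu>_j\<close>. This is how
  the entrywise product of two rotations arises.\<close>

lemma diag_inner_conjugate_diag:
  fixes P Q :: "real^'n^'n"
  shows "diag a \<bullet> (P ** diag \<nu> ** transpose Q) = a \<bullet> ((\<chi> i j. P $ i $ j * Q $ i $ j) *v \<nu>)"
proof -
  have "(P ** diag \<nu> ** transpose Q) $ i $ i = (\<Sum>j\<in>UNIV. P $ i $ j * Q $ i $ j * \<nu> $ j)" for i
    by (simp add: matrix_matrix_mult_def diag_def transpose_def if_distrib if_distribR cong: if_cong)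
      (simp add: ac_simps)
  then show ?thesis
    by (simp add: inner_vec_def diag_def matrix_vector_mult_def if_distrib if_distribR cong: if_cong)
qed

lemma diag_inner_diag: "diag a \<bullet> diag b = a \<bullet> b"
  by (simp add: inner_vec_def diag_def if_distrib if_distribR cong: if_cong)

lemma diag_linear: "linear diag"
  by (rule linearI) (auto simp: vec_eq_iff diag_def)

lemma isotropic_conjugate:
  assumes "isotropic W" "rotation_matrix P" "rotation_matrix Q"
  shows "W (P ** F ** transpose Q) = W F"
  using assms rotation_matrix_transpose unfolding isotropic_def by metis

text \<open>A minorant that exceeds \<open>t\<close> at \<open>diag \<nu>\<close> is carried to
  \<open>F = P diag \<nu> Q^T\<close> by composing it with the inverse conjugation. Isotropy keeps
  it below \<open>W\<close>, and \<open>adjoint\<close> says that it is again affine in the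
  minors.\<close>

lemma isotropic_lsc_polyconvexI:
  fixes W :: "real^'n^'n \<Rightarrow> ereal" and \<mu> :: "real^'n^'n \<Rightarrow> 'b::euclidean_space"
  assumes W: "into_Rinf W" "isotropic W"
    and adjoint: "\<And>P Q u. rotation_matrix P \<Longrightarrow> rotation_matrix Q \<Longrightarrow>
      \<exists>v. \<forall>F. v \<bullet> \<mu> F = u \<bullet> \<mu> (transpose P ** F ** Q)"
    and minorant: "\<And>\<nu> t. ereal t < W (diag \<nu>) \<Longrightarrow>
      \<exists>u e. (\<forall>F. ereal (u \<bullet> \<mu> F + e) \<le> W F) \<and> t < u \<bullet> \<mu> (diag \<nu>) + e"
  shows "lsc_polyconvex \<mu> W"
proof (rule lsc_polyconvexI[OF W(1)])
  fix F t assume "ereal t < W F"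
  obtain P Q \<nu> where F: "rotation_matrix P" "rotation_matrix Q" "F = P ** diag \<nu> ** transpose Q"
    by (rule signed_singular_value_decomposition)
  then have "W F = W (diag \<nu>)" using W isotropic_conjugate by blast
  then obtain u e where u: "\<And>F. ereal (u \<bullet> \<mu> F + e) \<le> W F" "t < u \<bullet> \<mu> (diag \<nu>) + e"
    using minorant \<open>ereal t < W F\<close> by metis
  obtain v where v: "\<And>F. v \<bullet> \<mu> F = u \<bullet> \<mu> (transpose P ** F ** Q)"
    using adjoint F by blast
  have "transpose P ** F ** Q = (transpose P ** P) ** diag \<nu> ** (transpose Q ** Q)"
    by (simp add: F(3) matrix_mul_assoc)
  then have "transpose P ** F ** Q = diag \<nu>"
    using F by (simp add: rotation_matrix_transpose_mult)
  moreover have "W (transpose P ** G ** Q) = W G" for G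
    using isotropic_conjugate[OF W(2), of "transpose P" "transpose Q"] F
    by (simp add: rotation_matrix_transpose)
  ultimately show "\<exists>u e. (\<forall>G. ereal (u \<bullet> \<mu> G + e) \<le> W G) \<and> t < u \<bullet> \<mu> F + e"
    using u v by metis
qed

lemma det_rotation_conjugate:
  fixes P Q F :: "real^'n^'n"
  assumes "rotation_matrix P" "rotation_matrix Q"
  shows "det (transpose P ** F ** Q) = det F" "det (P ** F ** transpose Q) = det F"
  using assms by (auto simp: det_mul rotation_matrix_def det_transpose)

subsection \<open>Dimension two\<close>

lemma det_diag_2: "det (diag \<nu>) = \<nu> $ 1 * \<nu> $ 2" for \<nu> :: "real^2"
  by (simp add: det_2 diag_def)

lemma minors2_diag: "minors2 (diag \<nu>) = (diag \<nu>, \<nu> $ 1 * \<nu> $ 2)"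
  by (simp add: minors2_def det_diag_2)

lemma rotation_matrix_2:
  fixes P :: "real^2^2"
  assumes "rotation_matrix P"
  shows "P $ 2 $ 2 = P $ 1 $ 1" "P $ 2 $ 1 = - P $ 1 $ 2" "(P $ 1 $ 1)\<^sup>2 + (P $ 1 $ 2)\<^sup>2 = 1"
proof -
  have "transpose P ** P = mat 1" "P ** transpose P = mat 1" "det P = 1"
    using assms by (auto simp: rotation_matrix_transpose_mult rotation_matrix_def)
  then have *: "P $ 1 $ 1 * P $ 1 $ 1 + P $ 1 $ 2 * P $ 1 $ 2 = 1"
     "P $ 2 $ 1 * P $ 2 $ 1 + P $ 2 $ 2 * P $ 2 $ 2 = 1"
     "P $ 1 $ 1 * P $ 2 $ 1 + P $ 1 $ 2 * P $ 2 $ 2 = 0"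
     "P $ 1 $ 1 * P $ 2 $ 2 - P $ 1 $ 2 * P $ 2 $ 1 = 1"
    by (auto simp: vec_eq_iff forall_2 matrix_matrix_mult_def sum_2 transpose_def mat_def det_2)
  show "(P $ 1 $ 1)\<^sup>2 + (P $ 1 $ 2)\<^sup>2 = 1" using *(1) by (simp add: power2_eq_square)
  show "P $ 2 $ 2 = P $ 1 $ 1" using * by algebra
  show "P $ 2 $ 1 = - P $ 1 $ 2" using * by algebra
qed

text \<open>Conjugation by the quarter turn \<open>R\<close> swaps the entries. The negative
  identity \<open>R ** R\<close> is a rotation too, and applied from one side it flips both
  signs.\<close>

lemma isotropic_2_symmetries:
  fixes W :: "real^2^2 \<Rightarrow> ereal"
  assumes "isotropic W"
  shows "W (diag (vector [\<nu> $ 2, \<nu> $ 1])) = W (diag \<nu>)" "W (diag (- \<nu>)) = W (diag \<nu>)"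
proof -
  define R :: "real^2^2" where "R = vector [vector [0, -1], vector [1, 0]]"
  have R: "rotation_matrix R"
    by (auto simp: R_def rotation_matrix_def orthogonal_matrix vec_eq_iff forall_2
        matrix_matrix_mult_def sum_2 transpose_def mat_def det_2)
  have "R ** diag \<nu> ** transpose R = diag (vector [\<nu> $ 2, \<nu> $ 1])"
    by (auto simp: R_def vec_eq_iff forall_2 matrix_matrix_mult_def sum_2 transpose_def diag_def)
  then show "W (diag (vector [\<nu> $ 2, \<nu> $ 1])) = W (diag \<nu>)"
    using isotropic_conjugate[OF assms R R] by metis
  have "(R ** R) ** diag \<nu> ** transpose (mat 1) = diag (- \<nu>)"
    by (auto simp: R_def vec_eq_iff forall_2 matrix_matrix_mult_def sum_2 transpose_def diag_def mat_def)
  moreover have "rotation_matrix (mat 1 :: real^2^2)"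
    by (simp add: rotation_matrix_def orthogonal_matrix_id)
  ultimately show "W (diag (- \<nu>)) = W (diag \<nu>)"
    using isotropic_conjugate[OF assms] rotation_matrix_mult[OF R R] by metis
qed

text \<open>A point of the l1 unit ball is a convex combination of signed unit vectors; in dimension
  two this takes the place of Birkhoff's theorem.\<close>

lemma linear_combination_le_of_abs_sum_le_1:
  fixes x y r s K :: real
  assumes "\<bar>x\<bar> + \<bar>y\<bar> \<le> 1" "\<bar>r\<bar> \<le> K" "\<bar>s\<bar> \<le> K"
  shows "x * r + y * s \<le> K"
proof -
  have "x * r + y * s \<le> \<bar>x\<bar> * \<bar>r\<bar> + \<bar>y\<bar> * \<bar>s\<bar>"
    by (metis abs_ge_self abs_mult add_mono)
  also have "\<dots> \<le> \<bar>x\<bar> * K + \<bar>y\<bar> * K"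
    using assms by (intro add_mono mult_left_mono) auto
  also have "\<dots> \<le> K"
    using assms mult_right_mono[of "\<bar>x\<bar> + \<bar>y\<bar>" 1 K] by (simp add: algebra_simps)
  finally show ?thesis .
qed

text \<open>Here the entrywise product of \<open>P\<close> and \<open>Q\<close> has rows
  \<open>(x, y)\<close> and \<open>(y, x)\<close>, so it maps \<open>\<nu>\<close> to
  \<open>x \<nu> + y \<nu>'\<close>. Unit rows of \<open>P\<close> and \<open>Q\<close> give
  \<open>\<bar>x\<bar> + \<bar>y\<bar> \<le> 1\<close>, while \<open>W\<close> and the determinant
  agree on the diagonal matrices of \<open>\<nu>\<close>, \<open>\<nu>'\<close> and their
  negatives.\<close>

lemma lsc_polyconvex_minors2:
  fixes W :: "real^2^2 \<Rightarrow> ereal"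
  assumes W: "into_Rinf W" "isotropic W"
    and g: "lsc_convex g" "\<And>\<nu>. W (diag \<nu>) = g (m2 \<nu>)"
  shows "lsc_polyconvex minors2 W"
proof (rule isotropic_lsc_polyconvexI[OF W])
  fix P Q :: "real^2^2" and u
  assume "rotation_matrix P" "rotation_matrix Q"
  then have "\<forall>F. (P ** fst u ** transpose Q, snd u) \<bullet> minors2 F = u \<bullet> minors2 (transpose P ** F ** Q)"
    by (cases u) (simp add: minors2_def det_rotation_conjugate matrix_inner_conjugate)
  then show "\<exists>v. \<forall>F. v \<bullet> minors2 F = u \<bullet> minors2 (transpose P ** F ** Q)" by blast
next
  fix \<nu>0 t assume "ereal t < W (diag \<nu>0)"
  then obtain u e where u: "\<And>z. ereal (u \<bullet> z + e) \<le> g z" "t < u \<bullet> m2 \<nu>0 + e"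
    using lsc_convex_affine_minorant[OF g(1)] g(2) by metis
  obtain a c where ac: "u = (a, c)" by (cases u)
  have "ereal ((diag a, c) \<bullet> minors2 F + e) \<le> W F" for F
  proof -
    obtain P Q \<nu> where F: "rotation_matrix P" "rotation_matrix Q" "F = P ** diag \<nu> ** transpose Q"
      by (rule signed_singular_value_decomposition)
    have WF: "W F = W (diag \<nu>)" using F W isotropic_conjugate by blast
    show ?thesis
    proof (cases "W (diag \<nu>)")
      case (real w)
      define \<nu>' :: "real^2" where "\<nu>' = vector [\<nu> $ 2, \<nu> $ 1]"
      define K where "K = w - c * (\<nu> $ 1 * \<nu> $ 2) - e"
      have bound: "a \<bullet> \<xi> \<le> K" if "W (diag \<xi>) = W (diag \<nu>)" "\<xi> $ 1 * \<xi> $ 2 = \<nu> $ 1 * \<nu> $ 2" for \<xi>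
        using u(1)[of "m2 \<xi>"] that real unfolding g(2)[symmetric] by (simp add: ac m2_def K_def)
      have "\<bar>a \<bullet> \<nu>\<bar> \<le> K" "\<bar>a \<bullet> \<nu>'\<bar> \<le> K"
        using bound[of \<nu>] bound[of "- \<nu>"] bound[of \<nu>'] bound[of "- \<nu>'"]
          isotropic_2_symmetries[OF W(2)]
        by (auto simp: \<nu>'_def abs_le_iff)
      moreover have "\<bar>P $ 1 $ 1 * Q $ 1 $ 1\<bar> + \<bar>P $ 1 $ 2 * Q $ 1 $ 2\<bar> \<le> 1"
      proof -
        have "2 * \<bar>x * y\<bar> \<le> x\<^sup>2 + y\<^sup>2" for x y :: real
          using sum_squares_bound[of "\<bar>x\<bar>" "\<bar>y\<bar>"] by (simp add: abs_mult)
        from this[of "P $ 1 $ 1" "Q $ 1 $ 1"] this[of "P $ 1 $ 2" "Q $ 1 $ 2"] show ?thesis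
          using rotation_matrix_2(3)[OF F(1)] rotation_matrix_2(3)[OF F(2)] by linarith
      qed
      ultimately have "(P $ 1 $ 1 * Q $ 1 $ 1) * (a \<bullet> \<nu>) + (P $ 1 $ 2 * Q $ 1 $ 2) * (a \<bullet> \<nu>') \<le> K"
        by (intro linear_combination_le_of_abs_sum_le_1)
      also have "(P $ 1 $ 1 * Q $ 1 $ 1) * (a \<bullet> \<nu>) + (P $ 1 $ 2 * Q $ 1 $ 2) * (a \<bullet> \<nu>') = diag a \<bullet> F"
        unfolding F(3) diag_inner_conjugate_diag
        by (simp add: inner_vec_def matrix_vector_mult_def sum_2 \<nu>'_def
            rotation_matrix_2[OF F(1)] rotation_matrix_2[OF F(2)] algebra_simps)
      finally have "diag a \<bullet> F \<le> K" .
      moreover have "det F = \<nu> $ 1 * \<nu> $ 2"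
        using F by (simp add: det_rotation_conjugate det_diag_2)
      ultimately show ?thesis
        unfolding WF real by (simp add: minors2_def K_def)
    qed (use W in \<open>auto simp: WF into_Rinf_def\<close>)
  qed
  moreover have "(diag a, c) \<bullet> minors2 (diag \<nu>0) = u \<bullet> m2 \<nu>0"
    by (simp add: ac minors2_diag m2_def diag_inner_diag)
  ultimately show "\<exists>u e. (\<forall>F. ereal (u \<bullet> minors2 F + e) \<le> W F) \<and> t < u \<bullet> minors2 (diag \<nu>0) + e"
    using u(2) by metis
qed

subsection \<open>Dimension three\<close>

lemma adjugate_mult_self_3:
  fixes F :: "real^3^3"
  shows "adjugate F ** F = mat (det F)"
  by (simp add: adjugate_3 vec_eq_iff forall_3 matrix_matrix_mult_def sum_3 mat_def det_3 algebra_simps)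

lemma cofactor_mult_3:
  fixes A B :: "real^3^3"
  shows "transpose (adjugate (A ** B)) = transpose (adjugate A) ** transpose (adjugate B)"
  by (simp add: adjugate_3 vec_eq_iff forall_3 transpose_def matrix_matrix_mult_def sum_3)
     (simp add: algebra_simps)

text \<open>The adjugate is the determinant times the inverse, here the transpose. By
  multiplicativity, the cofactor matrix of a conjugate is then conjugated by the same
  rotations.\<close>

lemma cofactor_rotation_3:
  fixes R :: "real^3^3"
  assumes "rotation_matrix R"
  shows "transpose (adjugate R) = R"
proof -
  have "adjugate R = (adjugate R ** R) ** transpose R"
    using assms by (simp add: rotation_matrix_transpose_mult flip: matrix_mul_assoc)
  also have "\<dots> = transpose R"
    using assms by (simp add: adjugate_mult_self_3 rotation_matrix_def)
  finally show ?thesis by simp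
qed

definition cofactors :: "real^3 \<Rightarrow> real^3" where
  "cofactors \<nu> = vector [\<nu> $ 2 * \<nu> $ 3, \<nu> $ 1 * \<nu> $ 3, \<nu> $ 1 * \<nu> $ 2]"

lemma cofactor_diag_3: "transpose (adjugate (diag \<nu>)) = diag (cofactors \<nu>)"
  by (simp add: adjugate_3 vec_eq_iff forall_3 transpose_def diag_def cofactors_def)

lemma det_diag_3: "det (diag \<nu>) = \<nu> $ 1 * \<nu> $ 2 * \<nu> $ 3" for \<nu> :: "real^3"
  by (simp add: det_3 diag_def)

lemma m3_eq: "m3 \<nu> = (\<nu>, cofactors \<nu>, \<nu> $ 1 * \<nu> $ 2 * \<nu> $ 3)"
  by (simp add: m3_def cofactors_def)

lemma minors3_diag: "minors3 (diag \<nu>) = (diag \<nu>, diag (cofactors \<nu>), \<nu> $ 1 * \<nu> $ 2 * \<nu> $ 3)"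
  by (simp add: minors3_def cofactor_diag_3 det_diag_3)

lemma minors3_conjugate:
  assumes "rotation_matrix P" "rotation_matrix Q"
  shows "minors3 (P ** F ** Q) = (P ** F ** Q, P ** transpose (adjugate F) ** Q, det F)"
  using assms by (simp add: minors3_def cofactor_mult_3 cofactor_rotation_3)
    (simp add: det_mul rotation_matrix_def)

lemma rotation_matrix_3_row_sqr:
  fixes R :: "real^3^3"
  assumes "rotation_matrix R"
  shows "(R $ i $ 1)\<^sup>2 + (R $ i $ 2)\<^sup>2 + (R $ i $ 3)\<^sup>2 = 1"
proof -
  have "(R ** transpose R) $ i $ i = 1"
    using assms by (simp add: rotation_matrix_transpose_mult mat_def)
  then show ?thesis
    by (simp add: matrix_matrix_mult_def sum_3 transpose_def power2_eq_square)
qed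

text \<open>The squared skew part of a rotation \<open>R\<close> equals \<open>(3 - trace R) (1 + trace R)\<close>, because \<open>R\<close> is its
  own cofactor matrix.\<close>

lemma trace_rotation_matrix_3:
  fixes R :: "real^3^3"
  assumes "rotation_matrix R"
  shows "- 1 \<le> trace R"
proof -
  have cof: "R $ 1 $ 1 = R$2$2 * R$3$3 - R$2$3 * R$3$2" "R $ 2 $ 2 = R$1$1 * R$3$3 - R$1$3 * R$3$1"
    "R $ 3 $ 3 = R$1$1 * R$2$2 - R$1$2 * R$2$1"
    using cofactor_rotation_3[OF assms]
    by (simp_all add: vec_eq_iff forall_3 transpose_def adjugate_3)
  note sqr = rotation_matrix_3_row_sqr[OF assms, of 1] rotation_matrix_3_row_sqr[OF assms, of 2]
    rotation_matrix_3_row_sqr[OF assms, of 3]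
  define \<tau> where "\<tau> = R $ 1 $ 1 + R $ 2 $ 2 + R $ 3 $ 3"
  have "(3 - \<tau>) * (1 + \<tau>) = (R$1$2 - R$2$1)\<^sup>2 + (R$1$3 - R$3$1)\<^sup>2 + (R$2$3 - R$3$2)\<^sup>2"
    using cof sqr unfolding \<tau>_def by algebra
  then have "0 \<le> (3 - \<tau>) * (1 + \<tau>)" by simp
  then have "- 1 \<le> \<tau>"
    by (cases "\<tau> < -1") (auto simp: zero_le_mult_iff)
  then show ?thesis by (simp add: trace_def sum_3 \<tau>_def)
qed

text \<open>The vertices of a regular tetrahedron. Its isometries are exactly the coordinate permutations
  combined with an even number of sign changes, which are the symmetries of isotropic functions on
  diagonal matrices; indexing them by permutations of the vertices is what links them to the
  4 by 4 Birkhoff polytope.\<close>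

definition tetra :: "nat \<Rightarrow> real^3" where
  "tetra k = (if k = 0 then vector [1, 1, 1] else if k = 1 then vector [1, -1, -1]
     else if k = 2 then vector [-1, 1, -1] else vector [-1, -1, 1])"

text \<open>The vertices form a tight frame; this is the reconstruction of \<open>x\<close> from its
  frame coefficients after permuting them. For a permutation \<open>p\<close> of the indices it
  carries \<open>tetra (p k)\<close> to \<open>tetra k\<close>, so composition reverses
  order.\<close>

definition tetra_isometry :: "(nat \<Rightarrow> nat) \<Rightarrow> real^3 \<Rightarrow> real^3" where
  "tetra_isometry p x = (1 / 4) *\<^sub>R (\<Sum>k<4. (tetra (p k) \<bullet> x) *\<^sub>R tetra k)"

lemma sum_lessThan_4: "(\<Sum>k<4. f k) = f 0 + f 1 + f 2 + f 3"
  for f :: "nat \<Rightarrow> 'a::comm_monoid_add"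
  by (simp add: eval_nat_numeral)

lemma less_4_cases: "k < 4 \<longleftrightarrow> k = 0 \<or> k = 1 \<or> k = 2 \<or> k = (3::nat)"
  by auto

lemma inner_3: "x \<bullet> y = x $ 1 * y $ 1 + x $ 2 * y $ 2 + x $ 3 * (y $ 3 :: real)" for x :: "real^3"
  by (simp add: inner_vec_def sum_3)

lemma sum_tetra: "(\<Sum>k<4. tetra k) = 0"
  by (simp add: sum_lessThan_4 tetra_def vec_eq_iff forall_3)

lemma sum_tetra_inner: "(\<Sum>k<4. tetra k \<bullet> x) = 0"
  by (simp flip: inner_sum_left add: sum_tetra)

lemma inner_tetra: "j < 4 \<Longrightarrow> k < 4 \<Longrightarrow> tetra j \<bullet> tetra k = (if j = k then 4 else 0) - 1"
  by (auto simp: less_4_cases tetra_def inner_3)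

lemma tetra_parseval: "(\<Sum>k<4. (tetra k \<bullet> x) * (tetra k \<bullet> y)) = 4 * (x \<bullet> y)"
  by (simp add: sum_lessThan_4 tetra_def inner_3 algebra_simps)

lemma tetra_eqI:
  assumes "\<And>k. k < 4 \<Longrightarrow> tetra k \<bullet> x = tetra k \<bullet> y"
  shows "x = y"
proof -
  have "4 * ((x - y) \<bullet> (x - y)) = 0"
    unfolding tetra_parseval[symmetric] using assms by (simp add: inner_diff_right)
  then show ?thesis by simp
qed

lemma tetra_inner_isometry:
  assumes "p permutes {..<4}" "k < 4"
  shows "tetra k \<bullet> tetra_isometry p x = tetra (p k) \<bullet> x"
proof -
  have "4 * (tetra k \<bullet> tetra_isometry p x) = (\<Sum>j<4. (tetra (p j) \<bullet> x) * (tetra k \<bullet> tetra j))"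
    by (simp add: tetra_isometry_def inner_sum_right)
  also have "\<dots> = (\<Sum>j<4. (if j = k then 4 * (tetra (p k) \<bullet> x) else 0) - tetra (p j) \<bullet> x)"
    using assms(2) by (intro sum.cong) (auto simp: inner_tetra algebra_simps)
  also have "\<dots> = 4 * (tetra (p k) \<bullet> x) - (\<Sum>j<4. tetra (p j) \<bullet> x)"
    using assms(2) by (simp add: sum_subtractf)
  also have "(\<Sum>j<4. tetra (p j) \<bullet> x) = 0"
    using sum.permute[OF assms(1), of "\<lambda>j. tetra j \<bullet> x"] by (simp add: sum_tetra_inner o_def)
  finally show ?thesis by simp
qed

text \<open>The entries of a vertex are signs with product 1, so each product of two is the third.
  The mixed terms of the square are therefore twice the inner product with the cofactors.\<close>

lemma tetra_inner_cofactors: "tetra k \<bullet> cofactors \<nu> = ((tetra k \<bullet> \<nu>)\<^sup>2 - \<nu> \<bullet> \<nu>) / 2"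
  by (simp add: tetra_def cofactors_def inner_3 power2_eq_square field_simps)

text \<open>Of the cubic monomials only \<open>\<nu>_1 \<nu>_2 \<nu>_3\<close> survives summation
  over the vertices, with coefficient 6 at each of the four. So the determinant is symmetric in the
  four vertex products.\<close>

lemma sum_tetra_inner_cube: "(\<Sum>k<4. (tetra k \<bullet> \<nu>) ^ 3) = 24 * (\<nu> $ 1 * \<nu> $ 2 * \<nu> $ 3)"
  by (simp add: sum_lessThan_4 tetra_def inner_3 power3_eq_cube algebra_simps)

lemma sum_permuted_tetra:
  assumes "p permutes {..<4}"
  shows "(\<Sum>k<4. f (tetra k \<bullet> tetra_isometry p x)) = (\<Sum>k<4. f (tetra k \<bullet> x))"
proof -
  have "(\<Sum>k<4. f (tetra k \<bullet> tetra_isometry p x)) = (\<Sum>k<4. f (tetra (p k) \<bullet> x))"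
    using assms by (simp add: tetra_inner_isometry)
  then show ?thesis using sum.permute[OF assms, of "\<lambda>j. f (tetra j \<bullet> x)"] by (simp add: o_def)
qed

lemma tetra_isometry_prod:
  assumes "p permutes {..<4}"
  shows "tetra_isometry p \<nu> $ 1 * tetra_isometry p \<nu> $ 2 * tetra_isometry p \<nu> $ 3 = \<nu> $ 1 * \<nu> $ 2 * \<nu> $ 3"
  using sum_permuted_tetra[OF assms, of "\<lambda>t. t ^ 3" \<nu>] unfolding sum_tetra_inner_cube by simp

lemma tetra_isometry_cofactors:
  assumes "p permutes {..<4}"
  shows "cofactors (tetra_isometry p \<nu>) = tetra_isometry p (cofactors \<nu>)"
proof (rule tetra_eqI)
  fix k :: nat assume "k < 4"
  have "tetra_isometry p \<nu> \<bullet> tetra_isometry p \<nu> = \<nu> \<bullet> \<nu>"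
    using sum_permuted_tetra[OF assms, of "\<lambda>t. t * t" \<nu>] unfolding tetra_parseval by simp
  then show "tetra k \<bullet> cofactors (tetra_isometry p \<nu>) = tetra k \<bullet> tetra_isometry p (cofactors \<nu>)"
    using assms \<open>k < 4\<close> by (simp add: tetra_inner_isometry tetra_inner_cofactors)
qed

lemma tetra_isometry_comp:
  assumes "p permutes {..<4}" "q permutes {..<4}"
  shows "tetra_isometry (q \<circ> p) x = tetra_isometry p (tetra_isometry q x)"
proof (rule tetra_eqI)
  fix k :: nat assume k: "k < 4"
  then have "p k < 4" using permutes_in_image[OF assms(1), of k] by simp
  with k show "tetra k \<bullet> tetra_isometry (q \<circ> p) x = tetra k \<bullet> tetra_isometry p (tetra_isometry q x)"
    using assms by (simp add: tetra_inner_isometry permutes_compose)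
qed

text \<open>Conjugation by a quarter turn \<open>P\<close> about a coordinate axis swaps the other
  two entries; \<open>P ** diag \<nu> ** P\<close> differs from it by the half turn
  \<open>P ** P\<close>, which flips their signs. These six maps realise the transpositions of the
  vertices of the tetrahedron.\<close>

lemma isotropic_3_swaps:
  fixes W :: "real^3^3 \<Rightarrow> ereal"
  assumes W: "isotropic W"
  shows "W (diag (vector [\<nu> $ 1, \<nu> $ 3, \<nu> $ 2])) = W (diag \<nu>)"
    "W (diag (vector [\<nu> $ 1, - \<nu> $ 3, - \<nu> $ 2])) = W (diag \<nu>)"
    "W (diag (vector [\<nu> $ 3, \<nu> $ 2, \<nu> $ 1])) = W (diag \<nu>)"
    "W (diag (vector [- \<nu> $ 3, \<nu> $ 2, - \<nu> $ 1])) = W (diag \<nu>)"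
    "W (diag (vector [\<nu> $ 2, \<nu> $ 1, \<nu> $ 3])) = W (diag \<nu>)"
    "W (diag (vector [- \<nu> $ 2, - \<nu> $ 1, \<nu> $ 3])) = W (diag \<nu>)"
proof -
  note mat_simps = vec_eq_iff forall_3 matrix_matrix_mult_def sum_3 transpose_def mat_def det_3 diag_def
  define R1 R2 R3 :: "real^3^3" where
    R_defs: "R1 = vector [vector [1, 0, 0], vector [0, 0, -1], vector [0, 1, 0]]"
      "R2 = vector [vector [0, 0, -1], vector [0, 1, 0], vector [1, 0, 0]]"
      "R3 = vector [vector [0, -1, 0], vector [1, 0, 0], vector [0, 0, 1]]"
  have R: "rotation_matrix R1" "rotation_matrix R2" "rotation_matrix R3"
    by (simp_all add: R_defs rotation_matrix_def orthogonal_matrix mat_simps)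
  have inv: "W (P ** diag \<nu> ** transpose P) = W (diag \<nu>)" "W (P ** diag \<nu> ** P) = W (diag \<nu>)"
    if "rotation_matrix P" for P
    using W that rotation_matrix_transpose[OF that] unfolding isotropic_def by metis+
  have "diag (vector [\<nu> $ 1, \<nu> $ 3, \<nu> $ 2]) = R1 ** diag \<nu> ** transpose R1"
    "diag (vector [\<nu> $ 1, - \<nu> $ 3, - \<nu> $ 2]) = R1 ** diag \<nu> ** R1"
    "diag (vector [\<nu> $ 3, \<nu> $ 2, \<nu> $ 1]) = R2 ** diag \<nu> ** transpose R2"
    "diag (vector [- \<nu> $ 3, \<nu> $ 2, - \<nu> $ 1]) = R2 ** diag \<nu> ** R2"
    "diag (vector [\<nu> $ 2, \<nu> $ 1, \<nu> $ 3]) = R3 ** diag \<nu> ** transpose R3"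
    "diag (vector [- \<nu> $ 2, - \<nu> $ 1, \<nu> $ 3]) = R3 ** diag \<nu> ** R3"
    by (simp_all add: R_defs mat_simps)
  then show "W (diag (vector [\<nu> $ 1, \<nu> $ 3, \<nu> $ 2])) = W (diag \<nu>)"
    "W (diag (vector [\<nu> $ 1, - \<nu> $ 3, - \<nu> $ 2])) = W (diag \<nu>)"
    "W (diag (vector [\<nu> $ 3, \<nu> $ 2, \<nu> $ 1])) = W (diag \<nu>)"
    "W (diag (vector [- \<nu> $ 3, \<nu> $ 2, - \<nu> $ 1])) = W (diag \<nu>)"
    "W (diag (vector [\<nu> $ 2, \<nu> $ 1, \<nu> $ 3])) = W (diag \<nu>)"
    "W (diag (vector [- \<nu> $ 2, - \<nu> $ 1, \<nu> $ 3])) = W (diag \<nu>)"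
    using inv R by simp_all
qed

lemma tetra_isometry_transpositions:
  "tetra_isometry (Transposition.transpose 0 1) \<nu> = vector [\<nu> $ 1, - \<nu> $ 3, - \<nu> $ 2]"
  "tetra_isometry (Transposition.transpose 0 2) \<nu> = vector [- \<nu> $ 3, \<nu> $ 2, - \<nu> $ 1]"
  "tetra_isometry (Transposition.transpose 0 3) \<nu> = vector [- \<nu> $ 2, - \<nu> $ 1, \<nu> $ 3]"
  "tetra_isometry (Transposition.transpose 1 2) \<nu> = vector [\<nu> $ 2, \<nu> $ 1, \<nu> $ 3]"
  "tetra_isometry (Transposition.transpose 1 3) \<nu> = vector [\<nu> $ 3, \<nu> $ 2, \<nu> $ 1]"
  "tetra_isometry (Transposition.transpose 2 3) \<nu> = vector [\<nu> $ 1, \<nu> $ 3, \<nu> $ 2]"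
  by (simp_all add: tetra_isometry_def Transposition.transpose_def sum_lessThan_4 tetra_def
      vec_eq_iff forall_3 inner_3)

lemma isotropic_tetra_isometry:
  fixes W :: "real^3^3 \<Rightarrow> ereal"
  assumes W: "isotropic W" and p: "p permutes {..<4}"
  shows "W (diag (tetra_isometry p \<nu>)) = W (diag \<nu>)"
  using p finite_lessThan
proof (induction p arbitrary: \<nu> rule: permutes_induct)
  case id
  have "tetra_isometry id \<nu> = \<nu>"
    by (rule tetra_eqI) (simp add: tetra_inner_isometry permutes_id)
  then show ?case by (simp add: id_def)
next
  case (swap a b p)
  have less: "W (diag (tetra_isometry (Transposition.transpose i j) \<nu>)) = W (diag \<nu>)"
    if ij: "i < j" "j < 4" for i j :: nat and \<nu>
  proof -
    consider "i = 0" "j = 1" | "i = 0" "j = 2" | "i = 0" "j = 3" | "i = 1" "j = 2" | "i = 1" "j = 3"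
      | "i = 2" "j = 3"
      using ij by linarith
    then show ?thesis
      by cases (simp_all only: tetra_isometry_transpositions isotropic_3_swaps[OF W])
  qed
  have "W (diag (tetra_isometry (Transposition.transpose a b) \<nu>)) = W (diag \<nu>)" for \<nu>
    using swap(1-3) less[of a b] less[of b a] Transposition.transpose_commute[of a b]
    by (cases a b rule: linorder_cases) auto
  moreover have "tetra_isometry (Transposition.transpose a b \<circ> p) \<nu>
      = tetra_isometry p (tetra_isometry (Transposition.transpose a b) \<nu>)"
    using swap by (intro tetra_isometry_comp permutes_swap_id) auto
  ultimately show ?case
    using swap by (simp add: o_def)
qed

section \<open>Birkhoff's theorem for entrywise products of rotations\<close>

lemma rotation_matrix_diag_tetra: "rotation_matrix (diag (tetra k))"
  by (auto simp: rotation_matrix_def orthogonal_matrix tetra_def diag_def vec_eq_iff forall_3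
      matrix_matrix_mult_def sum_3 transpose_def mat_def det_3)

text \<open>Each \<open>D_k = diag (tetra k)\<close> is the identity or a half turn, and the
  right-hand side is the trace of the rotation \<open>(D_j P D_k)^T Q\<close>.\<close>

lemma tetra_hadamard_rotations:
  fixes P Q :: "real^3^3"
  assumes "rotation_matrix P" "rotation_matrix Q"
  shows "- 1 \<le> tetra j \<bullet> ((\<chi> i j. P $ i $ j * Q $ i $ j) *v tetra k)"
proof -
  have "rotation_matrix (transpose (diag (tetra j) ** P ** diag (tetra k)) ** Q)"
    by (intro rotation_matrix_mult rotation_matrix_transpose rotation_matrix_diag_tetra assms)
  from trace_rotation_matrix_3[OF this]
  have "- 1 \<le> (diag (tetra j) ** P ** diag (tetra k)) \<bullet> Q"
    by (simp add: matrix_inner_eq_trace)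
  also have "\<dots> = tetra j \<bullet> ((\<chi> i j. P $ i $ j * Q $ i $ j) *v tetra k)"
    by (simp add: inner_3 inner_vec_def[where 'a = "real^3"] sum_3 matrix_matrix_mult_def
        matrix_vector_mult_def diag_def algebra_simps)
  finally show ?thesis .
qed

text \<open>Both terms are treated at once because the hypothesis bounds only their sum at a common
  \<open>p\<close>.\<close>

lemma hadamard_rotations_bound:
  fixes P Q :: "real^3^3"
  assumes rot: "rotation_matrix P" "rotation_matrix Q"
    and bound: "\<And>p. p permutes {..<4} \<Longrightarrow> a \<bullet> tetra_isometry p x + b \<bullet> tetra_isometry p y \<le> K"
  defines "M \<equiv> (\<chi> i j. P $ i $ j * Q $ i $ j) :: real^3^3"
  shows "a \<bullet> (M *v x) + b \<bullet> (M *v y) \<le> K"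
proof -
  define Y where "Y j k = (1 + tetra j \<bullet> (M *v tetra k)) / 4" for j k
  \<comment> \<open>A single cost matrix for both terms; by \<open>tetra_parseval\<close> its sum
    along a permutation is four times the expression in \<open>bound\<close>.\<close>
  define C where "C j k = (tetra j \<bullet> a) * (tetra k \<bullet> x) + (tetra j \<bullet> b) * (tetra k \<bullet> y)" for j k
  have M: "v \<bullet> (M *v w) = w \<bullet> (v v* M)" for v w
    by (metis dot_lmul_matrix inner_commute)
  have "(\<Sum>j<4. \<Sum>k<4. Y j k * C j k) \<le> 1 * (4 * K)"
  proof (rule birkhoff_linear_bound)
    show "0 \<le> Y j k" for j k
      using tetra_hadamard_rotations[OF rot, of j k] by (simp add: Y_def M_def)
    show "(\<Sum>k<4. Y j k) = 1" for j
      by (simp add: Y_def M sum.distrib sum_tetra_inner flip: sum_divide_distrib)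
    show "(\<Sum>j<4. Y j k) = 1" for k
      by (simp add: Y_def sum.distrib sum_tetra_inner flip: sum_divide_distrib)
    fix p :: "nat \<Rightarrow> nat" assume p: "p permutes {..<4}"
    have "(\<Sum>j<4. C j (p j)) = 4 * (a \<bullet> tetra_isometry p x + b \<bullet> tetra_isometry p y)"
      using p by (simp add: C_def sum.distrib distrib_left tetra_inner_isometry flip: tetra_parseval)
    then show "(\<Sum>j<4. C j (p j)) \<le> 4 * K" using bound[OF p] by simp
  qed auto
  \<comment> \<open>The constant 1 in \<open>Y\<close> contributes nothing, as the vertices sum to
    zero; Parseval in \<open>k\<close> and in \<open>j\<close> handles the rest.\<close>
  moreover have "(\<Sum>j<4. \<Sum>k<4. Y j k * ((tetra j \<bullet> v) * (tetra k \<bullet> w))) = 4 * (v \<bullet> (M *v w))" for v w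
  proof -
    have "(\<Sum>k<4. Y j k * ((tetra j \<bullet> v) * (tetra k \<bullet> w))) = (tetra j \<bullet> v) * (tetra j \<bullet> (M *v w))" for j
    proof -
      have "(\<Sum>k<4. Y j k * ((tetra j \<bullet> v) * (tetra k \<bullet> w)))
          = (tetra j \<bullet> v) / 4 * ((\<Sum>k<4. tetra k \<bullet> w) + (\<Sum>k<4. (tetra k \<bullet> (tetra j v* M)) * (tetra k \<bullet> w)))"
        by (simp add: Y_def M sum_distrib_left distrib_left distrib_right add_divide_distrib
            flip: sum.distrib) (simp add: algebra_simps)
      also have "\<dots> = (tetra j \<bullet> v) * (tetra j \<bullet> (M *v w))"
        unfolding sum_tetra_inner tetra_parseval M by (simp add: inner_commute)
      finally show ?thesis .
    qed
    then show ?thesis by (simp add: tetra_parseval)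
  qed
  ultimately show ?thesis
    by (simp add: C_def distrib_left sum.distrib)
qed

lemma lsc_polyconvex_minors3:
  fixes W :: "real^3^3 \<Rightarrow> ereal"
  assumes W: "into_Rinf W" "isotropic W"
    and g: "lsc_convex g" "\<And>\<nu>. W (diag \<nu>) = g (m3 \<nu>)"
  shows "lsc_polyconvex minors3 W"
proof (rule isotropic_lsc_polyconvexI[OF W])
  fix P Q :: "real^3^3" and u
  assume "rotation_matrix P" "rotation_matrix Q"
  then have "\<forall>F. (P ** fst u ** transpose Q, P ** fst (snd u) ** transpose Q, snd (snd u)) \<bullet> minors3 F
      = u \<bullet> minors3 (transpose P ** F ** Q)"
    by (cases u) (simp add: minors3_conjugate rotation_matrix_transpose matrix_inner_conjugate,
        simp add: minors3_def)
  then show "\<exists>v. \<forall>F. v \<bullet> minors3 F = u \<bullet> minors3 (transpose P ** F ** Q)" by blast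
next
  fix \<nu>0 t assume "ereal t < W (diag \<nu>0)"
  then obtain u e where u: "\<And>z. ereal (u \<bullet> z + e) \<le> g z" "t < u \<bullet> m3 \<nu>0 + e"
    using lsc_convex_affine_minorant[OF g(1)] g(2) by metis
  obtain a b c where abc: "u = (a, b, c)" by (cases u)
  have "ereal ((diag a, diag b, c) \<bullet> minors3 F + e) \<le> W F" for F
  proof -
    obtain P Q \<nu> where F: "rotation_matrix P" "rotation_matrix Q" "F = P ** diag \<nu> ** transpose Q"
      by (rule signed_singular_value_decomposition)
    have WF: "W F = W (diag \<nu>)" using F W isotropic_conjugate by blast
    show ?thesis
    proof (cases "W (diag \<nu>)")
      case (real w)
      define M :: "real^3^3" where "M = (\<chi> i j. P $ i $ j * Q $ i $ j)"
      have "a \<bullet> (M *v \<nu>) + b \<bullet> (M *v cofactors \<nu>) \<le> w - c * (\<nu> $ 1 * \<nu> $ 2 * \<nu> $ 3) - e"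
        unfolding M_def
      \<comment> \<open>Under each \<open>p\<close> the determinant is fixed, while
        \<open>\<nu>\<close> and its cofactors move by the same isometry; evaluating the minorant of
        \<open>g\<close> there gives the bound.\<close>
      proof (rule hadamard_rotations_bound[OF F(1,2)])
        fix p :: "nat \<Rightarrow> nat" assume p: "p permutes {..<4}"
        have "ereal (u \<bullet> m3 (tetra_isometry p \<nu>) + e) \<le> ereal w"
          using u(1)[of "m3 (tetra_isometry p \<nu>)"] isotropic_tetra_isometry[OF W(2) p, of \<nu>] real
          unfolding g(2)[symmetric] by simp
        then show "a \<bullet> tetra_isometry p \<nu> + b \<bullet> tetra_isometry p (cofactors \<nu>)
            \<le> w - c * (\<nu> $ 1 * \<nu> $ 2 * \<nu> $ 3) - e"
          by (simp add: abc m3_eq tetra_isometry_cofactors[OF p] tetra_isometry_prod[OF p])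
      qed
      moreover have "minors3 F = (F, P ** diag (cofactors \<nu>) ** transpose Q, \<nu> $ 1 * \<nu> $ 2 * \<nu> $ 3)"
        unfolding F(3) minors3_conjugate[OF F(1) rotation_matrix_transpose[OF F(2)]] cofactor_diag_3
          det_diag_3 ..
      ultimately show ?thesis
        unfolding WF real by (simp add: F(3) diag_inner_conjugate_diag M_def)
    qed (use W in \<open>auto simp: WF into_Rinf_def\<close>)
  qed
  moreover have "(diag a, diag b, c) \<bullet> minors3 (diag \<nu>0) = u \<bullet> m3 \<nu>0"
    by (simp add: abc minors3_diag m3_eq diag_inner_diag)
  ultimately show "\<exists>u e. (\<forall>F. ereal (u \<bullet> minors3 F + e) \<le> W F) \<and> t < u \<bullet> minors3 (diag \<nu>0) + e"
    using u(2) by metis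
qed

section \<open>Restriction to diagonal matrices and the equivalences\<close>

lemma lsc_convex_restrict_diag_2:
  assumes "lsc_polyconvex minors2 W"
  shows "\<exists>g. lsc_convex g \<and> (\<forall>\<nu>. W (diag \<nu>) = g (m2 \<nu>))"
proof -
  obtain G where G: "lsc_convex G" "\<And>F. W F = G (minors2 F)"
    using assms by (auto simp: lsc_polyconvex_def)
  \<comment> \<open>This linear map sends \<open>m2 \<nu>\<close> to the minors of
    \<open>diag \<nu>\<close>, so \<open>G\<close> composed with it is the required
    function.\<close>
  have "linear (\<lambda>z :: (real^2) \<times> real. (diag (fst z), snd z))"
    by (rule linearI) (auto simp: linear_add[OF diag_linear] linear_scale[OF diag_linear])
  from lsc_convex_compose_linear[OF G(1) this] show ?thesis
    by (intro exI conjI) (auto simp: G(2) minors2_diag m2_def)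
qed

lemma lsc_convex_restrict_diag_3:
  assumes "lsc_polyconvex minors3 W"
  shows "\<exists>g. lsc_convex g \<and> (\<forall>\<nu>. W (diag \<nu>) = g (m3 \<nu>))"
proof -
  obtain G where G: "lsc_convex G" "\<And>F. W F = G (minors3 F)"
    using assms by (auto simp: lsc_polyconvex_def)
  have "linear (\<lambda>z :: (real^3) \<times> (real^3) \<times> real. (diag (fst z), diag (fst (snd z)), snd (snd z)))"
    by (rule linearI) (auto simp: linear_add[OF diag_linear] linear_scale[OF diag_linear])
  from lsc_convex_compose_linear[OF G(1) this] show ?thesis
    by (intro exI conjI) (auto simp: G(2) minors3_diag m3_eq)
qed

theorem theorem1p4:
  shows
    "(\<forall>(W :: real^2^2 \<Rightarrow> ereal) (\<Phi> :: real^2 \<Rightarrow> ereal).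
        into_Rinf W \<longrightarrow> isotropic W \<longrightarrow> (\<forall>\<nu>. \<Phi> \<nu> = W (diag \<nu>)) \<longrightarrow>
          (lsc_polyconvex minors2 W \<longleftrightarrow>
             (\<exists>g :: (real^2) \<times> real \<Rightarrow> ereal. lsc_convex g \<and> (\<forall>\<nu>. W (diag \<nu>) = g (m2 \<nu>)))) \<and>
          ((\<exists>g :: (real^2) \<times> real \<Rightarrow> ereal. lsc_convex g \<and> (\<forall>\<nu>. W (diag \<nu>) = g (m2 \<nu>))) \<longleftrightarrow>
             lsc_polyconvex m2 \<Phi>)) \<and>
     (\<forall>(W :: real^3^3 \<Rightarrow> ereal) (\<Phi> :: real^3 \<Rightarrow> ereal).
        into_Rinf W \<longrightarrow> isotropic W \<longrightarrow> (\<forall>\<nu>. \<Phi> \<nu> = W (diag \<nu>)) \<longrightarrow>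
          (lsc_polyconvex minors3 W \<longleftrightarrow>
             (\<exists>g :: (real^3) \<times> (real^3) \<times> real \<Rightarrow> ereal. lsc_convex g \<and> (\<forall>\<nu>. W (diag \<nu>) = g (m3 \<nu>)))) \<and>
          ((\<exists>g :: (real^3) \<times> (real^3) \<times> real \<Rightarrow> ereal. lsc_convex g \<and> (\<forall>\<nu>. W (diag \<nu>) = g (m3 \<nu>))) \<longleftrightarrow>
             lsc_polyconvex m3 \<Phi>))"
proof (intro conjI allI impI, goal_cases)
  case (1 W \<Phi>)
  then show ?case using lsc_polyconvex_minors2 lsc_convex_restrict_diag_2 by blast
next
  case (2 W \<Phi>)
  then show ?case by (simp add: lsc_polyconvex_def)
next
  case (3 W \<Phi>)
  then show ?case using lsc_polyconvex_minors3 lsc_convex_restrict_diag_3 by blast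
next
  case (4 W \<Phi>)
  then show ?case by (simp add: lsc_polyconvex_def)
qed

end
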